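(* Every flat numerical semigroup $\mathcal{S}$ is symmetric; that is, if $f_{\mathcal{S}}$ denotes its Frobenius number, then for every $\ell\in\mathbb{Z}$ one has $\ell\in\mathcal{S}$ if and only if $f_{\mathcal{S}}-\ell\notin\mathcal{S}$.
   Context: A numerical semigroup is a submonoid of $\mathbb{N}=\{0,1,2,\dots\}$ with finite complement. Its Frobenius number $f_{\mathcal{S}}$ is the largest integer not contained in $\mathcal{S}$ (so $f_{\mathbb{N}}=-1$). Flat semigroups. For $A=\{a_1,\dots,a_n\}$ with $\gcd(a_1,\dots,a_n)=1$, put $q_i:=\gcd(a_j: j\neq i)$, $\widehat{q}_i:=\prod_{j\neq i}q_j$ and $\widehat{s}_i:=a_i/\widehat{q}_i$ (an integer, since the $q_i$ are pairwise relatively prime). $A$ is flat if $\widehat{s}_i=1$ for some $i$. A numerical semigroup is flat if its minimal set of generators is flat. The semigroup $\mathbb{N}$ is regarded as flat. *)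

theory Defs
  imports Complex_Main "HOL.Hull"
begin

definition add_submonoid :: "nat set \<Rightarrow> bool" where
  "add_submonoid S \<longleftrightarrow> 0 \<in> S \<and> (\<forall>x\<in>S. \<forall>y\<in>S. x + y \<in> S)"

definition numerical_semigroup :: "nat set \<Rightarrow> bool" where
  "numerical_semigroup S \<longleftrightarrow> add_submonoid S \<and> finite (UNIV - S)"

definition frobenius :: "nat set \<Rightarrow> int" where
  "frobenius S = (GREATEST z. z \<notin> int ` S)"

(* Every numerical semigroup has exactly one inclusion-minimal generating set. *)
definition minimal_generators :: "nat set \<Rightarrow> nat set \<Rightarrow> bool" where
  "minimal_generators A S \<longleftrightarrow>
     add_submonoid hull A = S \<and> (\<forall>B. B \<subset> A \<longrightarrow> add_submonoid hull B \<noteq> S)"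

(* The index i of a generator a_i is replaced by the generator itself, so a ranges over A. *)

definition q :: "nat set \<Rightarrow> nat \<Rightarrow> nat" where
  "q A a = Gcd (A - {a})"

definition q_hat :: "nat set \<Rightarrow> nat \<Rightarrow> nat" where
  "q_hat A a = (\<Prod>b\<in>A - {a}. q A b)"

(* The division is exact whenever Gcd A = 1; see q_hat_dvd. *)
definition s_hat :: "nat set \<Rightarrow> nat \<Rightarrow> nat" where
  "s_hat A a = a div q_hat A a"

lemma coprime_q:
  assumes "Gcd A = 1" "a \<noteq> b"
  shows "coprime (q A a) (q A b)"
proof (rule coprimeI)
  fix d assume d: "d dvd q A a" "d dvd q A b"
  have "d dvd x" if "x \<in> A" for x
  proof (cases "x = a")
    case True
    then show ?thesis
      using d(2) that assms(2) unfolding q_def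
      by (meson DiffI Gcd_dvd dvd_trans singletonD)
  next
    case False
    then show ?thesis
      using d(1) that unfolding q_def
      by (meson DiffI Gcd_dvd dvd_trans singletonD)
  qed
  then have "d dvd Gcd A" by (rule Gcd_greatest)
  then show "is_unit d" using assms(1) by simp
qed

lemma q_hat_dvd:
  assumes "Gcd A = 1" "a \<in> A"
  shows "q_hat A a dvd a"
proof -
  have "(\<Prod>b\<in>B. q A b) dvd a" if "finite B" "B \<subseteq> A - {a}" for B
    using that
  proof (induction B rule: finite_induct)
    case (insert b B)
    have "q A b dvd a"
      using insert.prems assms(2) by (auto simp: q_def intro!: Gcd_dvd)
    moreover have "coprime (q A b) (\<Prod>c\<in>B. q A c)"
      using insert.hyps by (intro prod_coprime_right coprime_q assms(1)) auto
    ultimately show ?case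
      using insert by (simp add: divides_mult)
  qed simp
  then show ?thesis
    unfolding q_hat_def by (cases "finite (A - {a})") auto
qed

definition flat_set :: "nat set \<Rightarrow> bool" where
  "flat_set A \<longleftrightarrow> finite A \<and> Gcd A = 1 \<and> (\<exists>a\<in>A. s_hat A a = 1)"

definition flat_semigroup :: "nat set \<Rightarrow> bool" where
  "flat_semigroup S \<longleftrightarrow> S = UNIV \<or> (\<exists>A. minimal_generators A S \<and> flat_set A)"

definition symmetric_semigroup :: "nat set \<Rightarrow> bool" where
  "symmetric_semigroup S \<longleftrightarrow>
     (\<forall>l::int. l \<in> int ` S \<longleftrightarrow> frobenius S - l \<notin> int ` S)"

end

(* Let a be a generator that equals the product of the q b over the other generators b. Since a
   divides q b * b, every element of S can be written as n * a + (SUM b. x b * b) with n >= 0 and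
   0 <= x b < q b. With n ranging over all integers such a representation exists for every
   integer (add a large multiple of a to enter S) and is unique (reduce modulo each q b). So
   membership in S means n >= 0, and the substitution n -> -1 - n, x b -> q b - 1 - x b is the
   reflection l -> f - l with f = (SUM b. (q b - 1) * b) - a. *)
theory Submission
  imports Defs
begin

lemma add_submonoid_hull: "add_submonoid (add_submonoid hull A)"
  by (rule hull_in) (auto simp: add_submonoid_def)

lemma add_submonoid_mult:
  assumes "add_submonoid S" "x \<in> S"
  shows "k * x \<in> S"
  using assms by (induction k) (auto simp: add_submonoid_def)

lemma add_submonoid_sum:
  assumes "add_submonoid S" "\<And>i. i \<in> I \<Longrightarrow> f i \<in> S"
  shows "sum f I \<in> S"
  using assms(2)
  by (induction I rule: infinite_finite_induct) (use assms(1) in \<open>auto simp: add_submonoid_def\<close>)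

text \<open>Any centre \<open>f\<close> of such a reflection is already the Frobenius number:
  \<open>f\<close> is the mirror image of 0, hence a gap, and the mirror image of any z > f is
  negative, hence z lies in \<open>S\<close>. No separate computation of \<open>frobenius S\<close>
  is required.\<close>

lemma symmetric_semigroupI:
  fixes S :: "nat set"
  assumes refl: "\<And>l::int. l \<in> int ` S \<longleftrightarrow> f - l \<notin> int ` S" and "0 \<in> S"
  shows "symmetric_semigroup S"
proof -
  have "frobenius S = f"
    unfolding frobenius_def
  proof (rule Greatest_equality)
    show "f \<notin> int ` S"
      using refl[of 0] \<open>0 \<in> S\<close> by force
    show "z \<le> f" if "z \<notin> int ` S" for z
      using refl[of z] that by auto
  qed
  with refl show ?thesis
    unfolding symmetric_semigroup_def by blast
qed

text \<open>\<open>a_eq\<close> is \<open>s_hat A a = 1\<close> with the exact division cleared.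
  \<open>a_pos\<close> excludes cases such as A = {0, 1} with a = 0, where \<open>a_eq\<close> holds
  but \<open>s_hat A a\<close> is \<open>0 div 0 = 0\<close>.\<close>

locale flat_generators =
  fixes A :: "nat set" and a :: nat
  assumes finite_A: "finite A" and Gcd_A: "Gcd A = 1" and a_in: "a \<in> A"
    and a_eq: "a = q_hat A a" and a_pos: "0 < a"
begin

lemma q_dvd: "c \<in> A \<Longrightarrow> c \<noteq> b \<Longrightarrow> q A b dvd c"
  unfolding q_def by (auto intro: Gcd_dvd)

lemma q_pos: "b \<in> A - {a} \<Longrightarrow> 0 < q A b"
  using q_dvd[of a b] a_in a_pos by (metis DiffD2 dvd_pos_nat singletonI)

lemma coprime_q_self:
  assumes "b \<in> A"
  shows "coprime b (q A b)"
proof -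
  have "gcd b (q A b) = Gcd (insert b (A - {b}))"
    by (simp only: Gcd_insert q_def)
  also have "\<dots> = 1"
    using assms Gcd_A by (simp add: insert_absorb)
  finally show ?thesis
    by (simp add: coprime_iff_gcd_eq_1)
qed

text \<open>Split the factor \<open>q A b\<close> off the product that equals \<open>a\<close>. The
  remaining factors all occur in \<open>q_hat A b\<close>, which divides \<open>b\<close>.\<close>

lemma a_dvd_q_mult:
  assumes "b \<in> A - {a}"
  shows "a dvd q A b * b"
proof -
  have "a = q A b * (\<Prod>c\<in>A - {a} - {b}. q A c)"
    using assms finite_A by (subst a_eq) (simp add: q_hat_def prod.remove)
  also have "\<dots> dvd q A b * q_hat A b"
    unfolding q_hat_def using finite_A by (intro mult_dvd_mono dvd_refl prod_dvd_prod_subset) auto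
  also have "\<dots> dvd q A b * b"
    using assms Gcd_A by (intro mult_dvd_mono dvd_refl q_hat_dvd) auto
  finally show ?thesis .
qed

definition normal :: "(nat \<Rightarrow> nat) \<Rightarrow> bool" where
  "normal x \<longleftrightarrow> (\<forall>b\<in>A - {a}. x b < q A b)"

definition val :: "(nat \<Rightarrow> nat) \<Rightarrow> int \<Rightarrow> int" where
  "val x n = n * int a + (\<Sum>b\<in>A - {a}. int (x b) * int b)"

text \<open>Each coefficient is divided with remainder by \<open>q A b\<close>; the quotient part is
  a multiple of \<open>a\<close> and moves into the coefficient of \<open>a\<close>. This
  coefficient can only grow, so it stays nonnegative.\<close>

lemma val_reduce: "\<exists>y k. normal y \<and> val x (int n) = val y (int (n + k))"
proof -
  define t where "t b = (x b div q A b) * (q A b * b div a)" for b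
  define y where "y b = x b mod q A b" for b
  have "int (x b) * int b = int (t b) * int a + int (y b) * int b" if "b \<in> A - {a}" for b
  proof -
    have "x b * b = (x b div q A b * q A b + y b) * b"
      by (simp only: y_def div_mult_mod_eq)
    also have "\<dots> = (x b div q A b) * (q A b * b) + y b * b"
      by (simp only: distrib_right mult.assoc)
    also have "(x b div q A b) * (q A b * b) = t b * a"
      unfolding t_def using a_dvd_q_mult[OF that] by (simp only: mult.assoc dvd_div_mult_self)
    finally show ?thesis
      by (simp only: flip: of_nat_mult of_nat_add)
  qed
  then have "val x (int n) = val y (int (n + (\<Sum>b\<in>A - {a}. t b)))"
    by (simp add: val_def sum.distrib sum_distrib_right distrib_right)
  moreover have "normal y"
    using q_pos by (simp add: normal_def y_def)
  ultimately show ?thesis by blast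
qed

text \<open>Modulo \<open>q A b\<close> every generator except \<open>b\<close> vanishes, while
  \<open>b\<close> is invertible. So the value determines x b modulo \<open>q A b\<close>, and
  normality determines x b itself; what remains is a multiple of \<open>a\<close>, which
  cancels.\<close>

lemma val_unique:
  assumes "normal x" "normal y" "val x n = val y m"
  shows "n = m"
proof -
  have "x b = y b" if b: "b \<in> A - {a}" for b
  proof -
    define Q where "Q = int (q A b)"
    have dvd: "Q dvd int c" if "c \<in> A" "c \<noteq> b" for c
      using q_dvd[OF that] by (simp add: Q_def)
    have split: "val z k =
        int (z b) * int b + (k * int a + (\<Sum>c\<in>A - {a} - {b}. int (z c) * int c))" for z k
      unfolding val_def using b finite_A by (simp add: sum.remove)
    have rest: "Q dvd k * int a + (\<Sum>c\<in>A - {a} - {b}. int (z c) * int c)" for z k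
      using b a_in by (intro dvd_add dvd_sum dvd_mult dvd) auto
    have "(int (x b) - int (y b)) * int b =
        (m * int a + (\<Sum>c\<in>A - {a} - {b}. int (y c) * int c)) -
        (n * int a + (\<Sum>c\<in>A - {a} - {b}. int (x c) * int c))"
      using assms(3) unfolding split[of x] split[of y] left_diff_distrib by linarith
    then have "Q dvd (int (x b) - int (y b)) * int b"
      by (simp only: dvd_diff rest)
    moreover have "coprime Q (int b)"
      using coprime_q_self[of b] b by (simp add: Q_def coprime_commute)
    ultimately have "Q dvd int (x b) - int (y b)"
      by (simp add: coprime_dvd_mult_left_iff)
    moreover have "x b < q A b" "y b < q A b"
      using assms(1,2) b by (simp_all add: normal_def)
    then have "\<bar>int (x b) - int (y b)\<bar> < \<bar>Q\<bar>"
      unfolding Q_def by linarith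
    ultimately have "int (x b) - int (y b) = 0"
      using dvd_imp_le_int by (meson not_le)
    then show ?thesis by simp
  qed
  then have "(\<Sum>b\<in>A - {a}. int (x b) * int b) = (\<Sum>b\<in>A - {a}. int (y b) * int b)"
    by (intro sum.cong) auto
  then show ?thesis
    using assms(3) a_pos by (simp add: val_def)
qed

lemma val_in_hull: "val x (int n) \<in> int ` (add_submonoid hull A)"
proof -
  let ?S = "add_submonoid hull A"
  have gen: "k * b \<in> ?S" if "b \<in> A" for k b
    using that by (intro add_submonoid_mult add_submonoid_hull) (rule hull_inc)
  then have "n * a \<in> ?S" "(\<Sum>b\<in>A - {a}. x b * b) \<in> ?S"
    using a_in by (auto intro!: add_submonoid_sum add_submonoid_hull)
  then have "n * a + (\<Sum>b\<in>A - {a}. x b * b) \<in> ?S"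
    using add_submonoid_hull[of A] by (auto simp: add_submonoid_def)
  moreover have "val x (int n) = int (n * a + (\<Sum>b\<in>A - {a}. x b * b))"
    by (simp add: val_def)
  ultimately show ?thesis by blast
qed

text \<open>The representable numbers form a submonoid containing \<open>A\<close>, and the hull is
  the smallest one.\<close>

lemma hull_representation:
  assumes "s \<in> add_submonoid hull A"
  shows "\<exists>x n. int s = val x (int n)"
proof -
  let ?T = "{s. \<exists>x n. int s = val x (int n)}"
  have "add_submonoid ?T"
    unfolding add_submonoid_def
  proof (intro conjI ballI)
    have "int 0 = val (\<lambda>_. 0) (int 0)" by (simp add: val_def)
    then show "0 \<in> ?T" by blast
  next
    fix s t assume "s \<in> ?T" "t \<in> ?T"
    then obtain x n y m where "int s = val x (int n)" "int t = val y (int m)" by blast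
    then have "int (s + t) = val (\<lambda>b. x b + y b) (int (n + m))"
      by (simp add: val_def sum.distrib distrib_right)
    then show "s + t \<in> ?T" by blast
  qed
  moreover have "A \<subseteq> ?T"
  proof
    fix b assume "b \<in> A"
    show "b \<in> ?T"
    proof (cases "b = a")
      case True
      then have "int b = val (\<lambda>_. 0) (int 1)" by (simp add: val_def)
      then show ?thesis by blast
    next
      case False
      then have "int b = val (\<lambda>c. if c = b then 1 else 0) (int 0)"
        using \<open>b \<in> A\<close> finite_A by (simp add: val_def if_distrib if_distribR sum.delta cong: if_cong)
      then show ?thesis by blast
    qed
  qed
  ultimately have "add_submonoid hull A \<subseteq> ?T"
    by (intro hull_minimal)
  with assms show ?thesis by blast
qed

text \<open>A member has some representation with nonnegative coefficient of \<open>a\<close>.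
  Reduction keeps the sign, and uniqueness identifies the result with n.\<close>

lemma val_mem_iff:
  assumes "normal x"
  shows "val x n \<in> int ` (add_submonoid hull A) \<longleftrightarrow> 0 \<le> n"
proof
  assume "val x n \<in> int ` (add_submonoid hull A)"
  then obtain y m where "val x n = val y (int m)"
    using hull_representation by (metis imageE)
  then obtain z k where "normal z" "val x n = val z (int k)"
    using val_reduce by metis
  then show "0 \<le> n"
    using val_unique[OF assms] by force
next
  assume "0 \<le> n"
  then show "val x n \<in> int ` (add_submonoid hull A)"
    using val_in_hull[of x "nat n"] by simp
qed

lemma int_representation:
  assumes "finite (UNIV - add_submonoid hull A)"
  shows "\<exists>x n. normal x \<and> l = val x n"
proof -
  obtain N where N: "\<And>s. s \<notin> add_submonoid hull A \<Longrightarrow> s < N"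
    using assms by (metis Compl_eq_Diff_UNIV Compl_iff bounded_nat_set_is_finite finite_nat_set_iff_bounded)
  \<comment> \<open>All gaps lie below N. Since a \<ge> 1, adding k copies of \<open>a\<close> lifts
    l to at least N.\<close>
  define k where "k = \<bar>l\<bar> + int N"
  have "k \<le> k * int a"
    using a_pos mult_left_mono[of 1 "int a" k] by (simp add: k_def)
  then have "int N \<le> l + k * int a"
    unfolding k_def by linarith
  then have "nat (l + k * int a) \<in> add_submonoid hull A" "0 \<le> l + k * int a"
    using N[of "nat (l + k * int a)"] by linarith+
  then obtain y m where "l + k * int a = val y (int m)"
    using hull_representation by (metis int_nat_eq)
  then obtain x n where "normal x" "l + k * int a = val x n"
    using val_reduce by metis
  then have "normal x \<and> l = val x (n - k)"
    by (simp add: val_def algebra_simps)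
  then show ?thesis by blast
qed

lemma symmetric_hull:
  assumes "finite (UNIV - add_submonoid hull A)"
  shows "symmetric_semigroup (add_submonoid hull A)"
proof (rule symmetric_semigroupI)
  \<comment> \<open>The largest gap: every coefficient is as large as normality allows, and the
    coefficient of \<open>a\<close> is the largest negative one.\<close>
  let ?f = "val (\<lambda>b. q A b - 1) (- 1)"
  fix l :: int
  obtain x n where x: "normal x" and l: "l = val x n"
    using int_representation[OF assms] by blast
  \<comment> \<open>By normality the natural subtraction does not truncate on
    \<open>A - {a}\<close>.\<close>
  define y where "y b = q A b - 1 - x b" for b
  have y: "normal y"
    unfolding normal_def y_def using q_pos by (simp add: less_imp_diff_less)
  have "int (q A b - 1) * int b = int (x b) * int b + int (y b) * int b" if "b \<in> A - {a}" for b
  proof -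
    have "q A b - 1 = x b + y b"
      using x that by (force simp: normal_def y_def)
    then show ?thesis
      by (simp add: distrib_right)
  qed
  then have "?f - l = val y (- 1 - n)"
    by (simp add: l val_def sum.distrib algebra_simps)
  \<comment> \<open>Exactly one of n and -1 - n is nonnegative.\<close>
  then show "l \<in> int ` (add_submonoid hull A) \<longleftrightarrow> ?f - l \<notin> int ` (add_submonoid hull A)"
    using val_mem_iff[OF x] val_mem_iff[OF y] l by auto
next
  show "0 \<in> add_submonoid hull A"
    using add_submonoid_hull[of A] by (simp add: add_submonoid_def)
qed

end

theorem mainTheorem4:
  fixes S :: "nat set"
  assumes "numerical_semigroup S" and "flat_semigroup S"
  shows "symmetric_semigroup S"
proof (cases "S = UNIV")
  case True
  \<comment> \<open>The disjunct \<open>S = UNIV\<close> of flatness supplies no generating set, so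
    this case is reflected directly, at the Frobenius number -1.\<close>
  have "l \<in> range int \<longleftrightarrow> - 1 - l \<notin> range int" for l :: int
    using nonneg_int_cases[of l] nonneg_int_cases[of "- 1 - l"] by force
  then show ?thesis
    unfolding True by (rule symmetric_semigroupI) simp
next
  case False
  then obtain A a where S: "add_submonoid hull A = S"
    and A: "finite A" "Gcd A = 1" "a \<in> A" "s_hat A a = 1"
    using assms(2) by (auto simp: flat_semigroup_def minimal_generators_def flat_set_def)
  have "a = q_hat A a"
    using q_hat_dvd[OF A(2,3)] A(4) unfolding s_hat_def by (metis dvd_div_mult_self mult_1)
  moreover have "0 < a"
    using A(4) by (auto simp: s_hat_def intro: gr0I)
  ultimately interpret flat_generators A a
    using A by unfold_locales
  show ?thesis
    using symmetric_hull assms(1) by (simp add: S numerical_semigroup_def)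
qed

end
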